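(* Let $t\in\mathbb{Z}_{\geq 0}$ and let $m,n\in\mathbb{Z}_{\geq 1}$ with $n\geq t+1$. Let $X$ be an alphabet (an arbitrary set), and let $a_i,b_i\in X^n$ for $i\in\{1,\ldots,m\}$. Assume that \begin{align*} \operatorname{dist}(a_i,b_i)&\geq t+1 &&\text{for every } i\in\{1,\ldots,m\},\\ \operatorname{dist}(a_i,b_j)&\leq t &&\text{whenever } 1\leq i<j\leq m. \end{align*} Then $$m\leq 2^{t+1}.$$ Moreover, if $|X|\geq 2$, equality is attained already when $n=t+1$: for every $t\in\mathbb{Z}_{\geq 0}$ and every alphabet $X$ with $|X|\geq 2$, there exist words $a_i,b_i\in X^{t+1}$ for $i\in\{1,\ldots,2^{t+1}\}$ such that $\operatorname{dist}(a_i,b_i)\geq t+1$ for every $i$ and $\operatorname{dist}(a_i,b_j)\leq t$ whenever $1\leq i<j\leq 2^{t+1}$.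
   Context: For a set $X$ (the alphabet, possibly infinite) and a positive integer $n$, $X^n$ is the set of words $x=(x_1,\ldots,x_n)$ of length $n$ over $X$. The Hamming distance between $x,y\in X^n$ is $\operatorname{dist}(x,y)=|\{k\in\{1,\ldots,n\}:x_k\neq y_k\}|$. *)

theory Defs
  imports Main
begin

definition words :: "'a set \<Rightarrow> nat \<Rightarrow> 'a list set" where
  "words X n = {w. set w \<subseteq> X \<and> length w = n}"

(* Meant for words of equal length; positions are 0-based, as usual for lists. *)
definition hamming_dist :: "'a list \<Rightarrow> 'a list \<Rightarrow> nat" where
  "hamming_dist x y = card {k. k < length x \<and> x ! k \<noteq> y ! k}"

end

theory Submission
  imports Defs "HOL-Computational_Algebra.Polynomial" "HOL-Library.Z2"
begin

text \<open>
  The bound is a dimension count. To every word \<open>x\<close> we attach an element \<open>E x\<close> of an algebra of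
  dimension \<open>2 ^ (t + 1)\<close>, whatever the length \<open>n\<close> and the alphabet are, together with a
  bilinear form that vanishes on \<open>(E x, E y)\<close> when \<open>x\<close> and \<open>y\<close> are at distance at most \<open>t\<close>, and
  that is nonzero on the pairs \<open>(E (a i), E (b i))\<close>. The matrix of the values on
  \<open>(E (a i), E (b j))\<close> is then triangular with nonzero diagonal, so \<open>m\<close> is at most the dimension
  (\<open>triangular_pairing_bound\<close>).

  The algebra is the exterior algebra on \<open>t + 1\<close> generators \<open>e_1, ..., e_(t+1)\<close> over an infinite
  integral domain of characteristic two. There it is commutative and every element of degree one has
  square zero. Represent letters by distinct scalars, choose a vector \<open>u_k\<close> of degree one for each
  coordinate \<open>k\<close>, and put \<open>E x = (1 + x_1 u_1) \<cdots> (1 + x_n u_n)\<close>. Since \<open>u_k\<close> squares to zero,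
  \<open>(1 + x_k u_k)(1 + y_k u_k) = 1 + (x_k + y_k) u_k\<close>, hence \<open>E x E y = E (x + y)\<close>
  (\<open>conv_ext_prod\<close>). In characteristic two \<open>x_k + y_k\<close> is zero exactly when \<open>x_k = y_k\<close>, so
  \<open>E x E y\<close> is a product of as many nontrivial factors as the Hamming distance of \<open>x\<close> and \<open>y\<close>.
  The bilinear form is the coefficient of \<open>e_1 \<cdots> e_(t+1)\<close> in \<open>E x E y\<close>: at most \<open>t\<close> nontrivial
  factors cannot reach degree \<open>t + 1\<close> (\<open>ext_prod_eq_0\<close>), and with at least \<open>t + 1\<close> of them the
  coefficient is nonzero for generic \<open>u_k\<close> (\<open>ex_generic_ext_prod_nonzero\<close>).

  Sharpness comes from the \<open>2 ^ (t + 1)\<close> words of length \<open>t + 1\<close> over two letters, each paired with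
  its complement: two distinct words differ somewhere, and there one agrees with the complement of
  the other.
\<close>

section \<open>Linear dependence over integral domains\<close>

text \<open>
  Gaussian elimination without division, as befits an integral domain: a pivot \<open>p\<close> for the equation \<open>s\<close> is eliminated by the cross products
  \<open>q p s * q j u - q j s * q p u\<close>.
\<close>
lemma ex_linear_dependence:
  fixes q :: "'i \<Rightarrow> 's \<Rightarrow> 'r::idom"
  assumes "finite S" "finite J" "card S < card J"
  shows "\<exists>c. (\<exists>j\<in>J. c j \<noteq> 0) \<and> (\<forall>s\<in>S. (\<Sum>j\<in>J. c j * q j s) = 0)"
  using assms
proof (induction S arbitrary: J q rule: finite_induct)
  case empty
  then have "J \<noteq> {}" by auto
  then show ?case by (intro exI[of _ "\<lambda>_. 1"]) auto
next
  case (insert s S)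
  show ?case
  proof (cases "\<forall>j\<in>J. q j s = 0")
    case True
    have "card S < card J" using insert by simp
    from insert.IH[OF insert.prems(1) this, of q] True show ?thesis by auto
  next
    case False
    then obtain p where p: "p \<in> J" "q p s \<noteq> 0" by blast
    define J' where "J' = J - {p}"
    define q' where "q' j u = q p s * q j u - q j s * q p u" for j u
    have J': "finite J'" "J = insert p J'" "p \<notin> J'"
      using p insert.prems by (auto simp: J'_def)
    have "card S < card J'" using insert.prems insert.hyps J' by simp
    from insert.IH[OF J'(1) this, of q'] obtain c where
      c: "\<exists>j\<in>J'. c j \<noteq> 0" "\<forall>u\<in>S. (\<Sum>j\<in>J'. c j * q' j u) = 0" by blast
    define c' where "c' j = (if j = p then - (\<Sum>j\<in>J'. c j * q j s) else c j * q p s)" for j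
    have eq: "(\<Sum>j\<in>J. c' j * q j u) = (\<Sum>j\<in>J'. c j * q' j u)" for u
    proof -
      have "(\<Sum>j\<in>J. c' j * q j u)
          = - (\<Sum>j\<in>J'. c j * q j s) * q p u + (\<Sum>j\<in>J'. c' j * q j u)"
        using J' by (simp add: c'_def)
      also have "(\<Sum>j\<in>J'. c' j * q j u) = (\<Sum>j\<in>J'. c j * q p s * q j u)"
        using J' by (intro sum.cong) (auto simp: c'_def)
      finally show ?thesis
        by (simp add: q'_def sum_distrib_left sum_distrib_right sum_subtractf algebra_simps)
    qed
    have "\<exists>j\<in>J. c' j \<noteq> 0" using c(1) p J' by (auto simp: c'_def)
    moreover have "\<forall>u\<in>insert s S. (\<Sum>j\<in>J. c' j * q j u) = 0"
      unfolding eq using c(2) by (auto simp: q'_def mult.commute)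
    ultimately show ?thesis by blast
  qed
qed

text \<open>
  If \<open>m\<close> exceeded the number of components, the vectors \<open>q j\<close> would satisfy a nontrivial linear
  relation. Pairing this relation with \<open>p i\<close>, where \<open>i\<close> is the least index with a nonzero coefficient,
  leaves only the diagonal term.
\<close>
lemma triangular_pairing_bound:
  fixes p q :: "nat \<Rightarrow> 's \<Rightarrow> 'r::idom"
  assumes S: "finite S"
    and diag: "\<And>i. i \<in> {1..m} \<Longrightarrow> (\<Sum>s\<in>S. p i s * q i s) \<noteq> 0"
    and upper: "\<And>i j. 1 \<le> i \<Longrightarrow> i < j \<Longrightarrow> j \<le> m \<Longrightarrow> (\<Sum>s\<in>S. p i s * q j s) = 0"
  shows "m \<le> card S"
proof (rule ccontr)
  assume "\<not> m \<le> card S"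
  then obtain c where c: "\<exists>j\<in>{1..m}. c j \<noteq> 0"
      and dep: "\<forall>s\<in>S. (\<Sum>j\<in>{1..m}. c j * q j s) = 0"
    using ex_linear_dependence[OF S, of "{1..m}" q] by auto
  define i where "i = (LEAST j. j \<in> {1..m} \<and> c j \<noteq> 0)"
  have "i \<in> {1..m} \<and> c i \<noteq> 0"
    unfolding i_def by (rule LeastI_ex) (use c in blast)
  then have i: "i \<in> {1..m}" "c i \<noteq> 0" by blast+
  have below: "c j = 0" if "j \<in> {1..m}" "j < i" for j
    using not_less_Least[of j "\<lambda>j. j \<in> {1..m} \<and> c j \<noteq> 0"] that unfolding i_def by auto
  have "0 = (\<Sum>s\<in>S. p i s * (\<Sum>j\<in>{1..m}. c j * q j s))" using dep by simp
  also have "\<dots> = (\<Sum>j\<in>{1..m}. c j * (\<Sum>s\<in>S. p i s * q j s))"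
    by (simp add: sum_distrib_left mult.left_commute) (rule sum.swap)
  also have "\<dots> = (\<Sum>j\<in>{i}. c j * (\<Sum>s\<in>S. p i s * q j s))"
  proof (rule sum.mono_neutral_right)
    show "\<forall>j\<in>{1..m} - {i}. c j * (\<Sum>s\<in>S. p i s * q j s) = 0"
    proof
      fix j assume "j \<in> {1..m} - {i}"
      then show "c j * (\<Sum>s\<in>S. p i s * q j s) = 0"
        using below[of j] upper[of i j] i by (cases "j < i") auto
    qed
  qed (use i in auto)
  finally show False using diag[OF i(1)] i(2) by simp
qed

section \<open>The exterior algebra in characteristic two\<close>

text \<open>
  An element of the exterior algebra is given by its coefficients: \<open>f T\<close> is the coefficient of the
  product of the generators with index in \<open>T\<close>. In characteristic two there are no signs, so the
  product is convolution over disjoint unions.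
\<close>
definition conv :: "('b set \<Rightarrow> 'r) \<Rightarrow> ('b set \<Rightarrow> 'r) \<Rightarrow> 'b set \<Rightarrow> 'r::comm_ring_1" where
  "conv f g T = (\<Sum>S\<in>Pow T. f S * g (T - S))"

text \<open>Multiplication by the element \<open>\<Sum>r. w r e_r\<close> of degree one.\<close>
definition vmult :: "('b \<Rightarrow> 'r) \<Rightarrow> ('b set \<Rightarrow> 'r) \<Rightarrow> 'b set \<Rightarrow> 'r::comm_ring_1" where
  "vmult w f T = (\<Sum>r\<in>T. w r * f (T - {r}))"

text \<open>
  The product of the factors \<open>1 + x_k u_k\<close>, where \<open>u_k\<close> is the vector \<open>\<Sum>r. z_k ^ r e_r\<close> on the
  moment curve. One scalar \<open>z_k\<close> per coordinate describes \<open>u_k\<close>, which turns genericity of \<open>u_k\<close>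
  into avoiding the roots of finitely many polynomials in one variable.
\<close>
fun ext_prod :: "'r list \<Rightarrow> 'r list \<Rightarrow> nat set \<Rightarrow> 'r::comm_ring_1" where
  "ext_prod (z # zs) (x # xs) =
     (\<lambda>T. ext_prod zs xs T + x * vmult (\<lambda>r. z ^ r) (ext_prod zs xs) T)"
| "ext_prod _ _ = (\<lambda>T. if T = {} then 1 else 0)"

lemma conv_commute:
  "conv f g T = conv g f T"
  unfolding conv_def
  by (rule sum.reindex_bij_witness[of _ "\<lambda>S. T - S" "\<lambda>S. T - S"])
     (auto simp: double_diff mult.commute)

lemma conv_vmult_left:
  assumes "finite T"
  shows "conv (vmult w f) g T = vmult w (conv f g) T"
proof -
  have "conv (vmult w f) g T
      = (\<Sum>(S, r)\<in>Sigma (Pow T) (\<lambda>S. S). w r * f (S - {r}) * g (T - S))"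
    unfolding conv_def vmult_def using assms
    by (subst sum.Sigma[symmetric]) (auto simp: sum_distrib_right intro: finite_subset)
  also have "\<dots> = (\<Sum>(r, S)\<in>Sigma T (\<lambda>r. Pow (T - {r})). w r * (f S * g (T - {r} - S)))"
  proof (rule sum.reindex_bij_witness[of _ "\<lambda>(r, S). (insert r S, r)" "\<lambda>(S, r). (r, S - {r})"],
      goal_cases)
    case (5 a)
    obtain S r where a: "a = (S, r)" "r \<in> S" "S \<subseteq> T" using 5 by auto
    then have "T - {r} - (S - {r}) = T - S" by auto
    then show ?case using a by (simp add: mult.assoc)
  qed auto
  also have "\<dots> = vmult w (conv f g) T"
    unfolding conv_def vmult_def using assms
    by (subst sum.Sigma[symmetric]) (auto simp: sum_distrib_left)
  finally show ?thesis .
qed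

lemma conv_vmult_right:
  assumes "finite T"
  shows "conv f (vmult w g) T = vmult w (conv f g) T"
proof -
  have "conv f g = conv g f" by (rule ext) (rule conv_commute)
  with conv_vmult_left[OF assms, of w g f] show ?thesis by (simp add: conv_commute)
qed

lemma vmult_cong:
  assumes "finite T" "\<And>S. finite S \<Longrightarrow> f S = g S"
  shows "vmult w f T = vmult w g T"
  unfolding vmult_def using assms by simp

text \<open>The terms for \<open>(r, s)\<close> and \<open>(s, r)\<close> cancel in pairs.\<close>
lemma sum_off_diagonal_symmetric:
  fixes h :: "'b \<Rightarrow> 'b \<Rightarrow> 'r::comm_ring_1"
  assumes char2: "(1::'r) + 1 = 0" and "finite T" and sym: "\<And>r s. h r s = h s r"
  shows "(\<Sum>r\<in>T. \<Sum>s\<in>T - {r}. h r s) = 0"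
  using \<open>finite T\<close>
proof (induction rule: finite_induct)
  case (insert x T)
  have "(\<Sum>r\<in>insert x T. \<Sum>s\<in>insert x T - {r}. h r s)
      = (\<Sum>s\<in>T. h x s) + (\<Sum>r\<in>T. h r x + (\<Sum>s\<in>T - {r}. h r s))"
  proof -
    have "(\<Sum>s\<in>insert x T - {r}. h r s) = h r x + (\<Sum>s\<in>T - {r}. h r s)" if "r \<in> T" for r
    proof -
      have "insert x T - {r} = insert x (T - {r})" using that insert by auto
      then show ?thesis using insert by simp
    qed
    then show ?thesis using insert by simp
  qed
  also have "\<dots> = (\<Sum>s\<in>T. h x s) + (\<Sum>s\<in>T. h x s)"
    using insert.IH by (simp add: sum.distrib sym[of _ x])
  also have "\<dots> = (1 + 1) * (\<Sum>s\<in>T. h x s)" by (simp add: distrib_right)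
  finally show ?case using char2 by simp
qed simp

text \<open>
  An element of degree one squares to zero: the coefficients \<open>w r * w s\<close> are symmetric, and a factor
  \<open>e_r e_r\<close> never occurs.
\<close>
lemma vmult_vmult_same:
  fixes w :: "'b \<Rightarrow> 'r::comm_ring_1"
  assumes "(1::'r) + 1 = 0" "finite T"
  shows "vmult w (vmult w f) T = 0"
proof -
  have "vmult w (vmult w f) T = (\<Sum>r\<in>T. \<Sum>s\<in>T - {r}. w r * w s * f (T - {r, s}))"
    unfolding vmult_def
    by (auto simp: sum_distrib_left mult.assoc insert_commute Diff_insert2[symmetric] intro!: sum.cong)
  also have "\<dots> = 0"
    by (rule sum_off_diagonal_symmetric[OF assms]) (simp add: insert_commute mult.commute)
  finally show ?thesis .
qed

text \<open>
  Coordinate by coordinate this is \<open>(1 + x u)(1 + y u) = 1 + (x + y) u\<close>. It makes the distance of two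
  words visible in a bilinear expression, since \<open>x + y\<close> depends on both words but each factor on
  the left depends on only one of them.
\<close>
lemma conv_ext_prod:
  fixes xs ys zs :: "'r::comm_ring_1 list"
  assumes char2: "(1::'r) + 1 = 0"
    and "length zs = length xs" "length xs = length ys" "finite T"
  shows "conv (ext_prod zs xs) (ext_prod zs ys) T = ext_prod zs (map2 (+) xs ys) T"
  using assms(2-)
proof (induction zs xs ys arbitrary: T rule: list_induct3)
  case Nil
  have "(\<Sum>S\<in>Pow T. (if S = {} then 1 else 0) * (if T - S = {} then 1 else (0::'r)))
      = (\<Sum>S\<in>{{}}. (if S = {} then 1 else 0) * (if T - S = {} then 1 else (0::'r)))"
    using Nil by (intro sum.mono_neutral_right) auto
  then show ?case by (simp add: conv_def)
next
  case (Cons z zs x xs y ys)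
  define w where "w = (\<lambda>r::nat. z ^ r)"
  define F where "F = ext_prod zs xs"
  define G where "G = ext_prod zs ys"
  define H where "H = ext_prod zs (map2 (+) xs ys)"
  have IH: "conv F G S = H S" if "finite S" for S
    using Cons that unfolding F_def G_def H_def by blast
  have FG: "vmult w (conv F G) T = vmult w H T"
    using Cons.prems IH by (rule vmult_cong)
  have FDG: "conv F (vmult w G) T = vmult w H T"
    using conv_vmult_right[OF Cons.prems, of F w G] FG by simp
  have DFG: "conv (vmult w F) G T = vmult w H T"
    using conv_vmult_left[OF Cons.prems, of w F G] FG by simp
  have DFDG: "conv (vmult w F) (vmult w G) T = 0"
  proof -
    have "conv (vmult w F) (vmult w G) T = vmult w (conv F (vmult w G)) T"
      by (rule conv_vmult_left[OF Cons.prems])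
    also have "\<dots> = vmult w (vmult w (conv F G)) T"
      by (rule vmult_cong[OF Cons.prems conv_vmult_right])
    also have "\<dots> = 0" by (rule vmult_vmult_same[OF char2 Cons.prems])
    finally show ?thesis .
  qed
  have "conv (\<lambda>T. F T + x * vmult w F T) (\<lambda>T. G T + y * vmult w G T) T
      = conv F G T + y * conv F (vmult w G) T + x * conv (vmult w F) G T
        + x * y * conv (vmult w F) (vmult w G) T"
    by (simp add: conv_def sum.distrib sum_distrib_left algebra_simps)
  also have "\<dots> = H T + (x + y) * vmult w H T"
    using IH[OF Cons.prems] FDG DFG DFDG by (simp add: algebra_simps)
  finally show ?case by (simp add: F_def G_def H_def w_def)
qed

section \<open>Detecting the number of nonzero coordinates\<close>

abbreviation weight :: "'r::zero list \<Rightarrow> nat" where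
  "weight xs \<equiv> length (filter (\<lambda>x. x \<noteq> 0) xs)"

text \<open>A product of \<open>w\<close> nontrivial factors \<open>1 + x u\<close> has no component of degree above \<open>w\<close>.\<close>
lemma ext_prod_eq_0:
  assumes "finite T" "weight xs < card T"
  shows "ext_prod zs xs T = 0"
  using assms
proof (induction zs xs arbitrary: T rule: ext_prod.induct)
  case (1 z zs x xs)
  show ?case
  proof (cases "x = 0")
    case True
    then show ?thesis using 1 by simp
  next
    case False
    have "ext_prod zs xs (T - {r}) = 0" if "r \<in> T" for r
      using 1 that False by (intro 1) auto
    moreover have "ext_prod zs xs T = 0" using 1 False by (intro 1) auto
    ultimately show ?thesis by (simp add: vmult_def)
  qed
qed auto

lemma ex_common_non_root:
  fixes P :: "'r::idom poly set"
  assumes "infinite (UNIV :: 'r set)" "finite P" "0 \<notin> P"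
  shows "\<exists>z. \<forall>p\<in>P. poly p z \<noteq> 0"
proof -
  have "finite (\<Union>p\<in>P. {z. poly p z = 0})"
    using assms by (auto intro!: poly_roots_finite)
  then obtain z where "z \<notin> (\<Union>p\<in>P. {z. poly p z = 0})"
    using assms(1) ex_new_if_finite by blast
  then show ?thesis by auto
qed

text \<open>
  The vectors \<open>u_k\<close> are chosen one coordinate at a time. The induction has to carry all \<open>T\<close> of size at
  most the weight, not just \<open>T = R\<close>: with a new factor \<open>1 + x u\<close>, \<open>x \<noteq> 0\<close>,
  the coefficient at \<open>T\<close> becomes a polynomial in the new parameter \<open>z\<close> whose coefficient at
  \<open>z ^ r\<close>, for \<open>r \<in> T\<close>, is \<open>x\<close> times the old coefficient at \<open>T - {r}\<close>, a smaller set. Hence it is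
  a nonzero polynomial, and some \<open>z\<close> avoids the roots of all of these. The index \<open>0\<close> is kept out of
  \<open>R\<close> because the constant term of the polynomial also receives the old coefficient at \<open>T\<close>, and the
  two contributions could cancel.
\<close>
lemma ex_generic_ext_prod_nonzero:
  fixes D :: "'r::idom list set"
  assumes inf: "infinite (UNIV :: 'r set)"
    and "finite D" "\<forall>d\<in>D. length d = n"
    and R: "finite R" "0 \<notin> R"
  shows "\<exists>zs. length zs = n \<and>
           (\<forall>d\<in>D. \<forall>T\<subseteq>R. card T \<le> weight d \<longrightarrow> ext_prod zs d T \<noteq> 0)"
  using assms(2,3)
proof (induction n arbitrary: D)
  case 0
  then have "d = []" if "d \<in> D" for d using that by auto
  moreover have "T = {}" if "T \<subseteq> R" "card T \<le> 0" for T
    using that R by (metis card_0_eq finite_subset le_zero_eq)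
  ultimately show ?case by (intro exI[of _ "[]"]) fastforce
next
  case (Suc n)
  have "finite (tl ` D)" "\<forall>d\<in>tl ` D. length d = n"
    using Suc.prems by auto
  from Suc.IH[OF this] obtain zs where zs: "length zs = n"
    and nz: "\<And>d T. d \<in> tl ` D \<Longrightarrow> T \<subseteq> R \<Longrightarrow> card T \<le> weight d \<Longrightarrow> ext_prod zs d T \<noteq> 0"
    by blast
  \<comment> \<open>The coefficient at \<open>T\<close> after adjoining the factor of the head of \<open>d\<close>, as a polynomial in the new parameter.\<close>
  define pol where "pol d T = [:ext_prod zs (tl d) T:] +
      smult (hd d) (\<Sum>r\<in>T. monom (ext_prod zs (tl d) (T - {r})) r)" for d T
  define P where "P = (\<lambda>(d, T). pol d T) ` {(d, T). d \<in> D \<and> T \<subseteq> R \<and> card T \<le> weight d}"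
  have "finite {(d, T). d \<in> D \<and> T \<subseteq> R \<and> card T \<le> weight d}"
    by (rule finite_subset[of _ "D \<times> Pow R"]) (use Suc.prems R in auto)
  then have "finite P" unfolding P_def by simp
  have pol_nz: "pol d T \<noteq> 0" if d: "d \<in> D" and T: "T \<subseteq> R" "card T \<le> weight d" for d T
  proof -
    obtain x xs where dx: "d = x # xs" using Suc.prems d by (cases d) auto
    have xs: "xs \<in> tl ` D" using d dx by force
    show ?thesis
    proof (cases "x = 0 \<or> T = {}")
      case True
      have "ext_prod zs xs T \<noteq> 0" using True T dx by (intro nz[OF xs]) auto
      then show ?thesis using True dx by (auto simp: pol_def)
    next
      case False
      then obtain r where r: "r \<in> T" by blast
      have finT: "finite T" using T R finite_subset by blast
      have "r \<in> R" using r T(1) by blast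
      then have "r \<noteq> 0" using R(2) by (intro notI) simp
      have "coeff (pol d T) r = x * (\<Sum>s\<in>T. if s = r then ext_prod zs xs (T - {s}) else 0)"
        using \<open>r \<noteq> 0\<close> dx by (cases r) (simp_all add: pol_def coeff_sum)
      also have "\<dots> = x * ext_prod zs xs (T - {r})"
        using r finT by simp
      also have "\<dots> \<noteq> 0"
      proof -
        have "card (T - {r}) \<le> weight xs" using T r False dx finT by simp
        then show ?thesis using nz[OF xs, of "T - {r}"] T False by auto
      qed
      finally show ?thesis by auto
    qed
  qed
  then have "0 \<notin> P" unfolding P_def by force
  with ex_common_non_root[OF inf \<open>finite P\<close>] obtain z where z: "\<forall>p\<in>P. poly p z \<noteq> 0" by blast
  have "ext_prod (z # zs) d T \<noteq> 0" if d: "d \<in> D" and T: "T \<subseteq> R" "card T \<le> weight d" for d T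
  proof -
    obtain x xs where dx: "d = x # xs" using Suc.prems d by (cases d) auto
    have "pol d T \<in> P" unfolding P_def using that by force
    with z have "poly (pol d T) z \<noteq> 0" by blast
    moreover have "poly (pol d T) z = ext_prod (z # zs) d T"
      by (simp add: pol_def dx vmult_def poly_sum poly_monom mult.commute)
    ultimately show ?thesis by simp
  qed
  then show ?case using zs by (intro exI[of _ "z # zs"]) auto
qed

section \<open>The upper bound\<close>

lemma hamming_dist_Cons:
  "hamming_dist (x # xs) (y # ys) = (if x = y then 0 else 1) + hamming_dist xs ys"
proof -
  have "{k. k < length (x # xs) \<and> (x # xs) ! k \<noteq> (y # ys) ! k}
      = (if x = y then {} else {0}) \<union> Suc ` {k. k < length xs \<and> xs ! k \<noteq> ys ! k}"
  proof (rule set_eqI)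
    fix k
    show "k \<in> {k. k < length (x # xs) \<and> (x # xs) ! k \<noteq> (y # ys) ! k} \<longleftrightarrow>
      k \<in> (if x = y then {} else {0}) \<union> Suc ` {k. k < length xs \<and> xs ! k \<noteq> ys ! k}"
      by (cases k) auto
  qed
  then show ?thesis
    unfolding hamming_dist_def by (auto simp: card_image card_insert_if)
qed

lemma weight_map2_eq_hamming_dist:
  fixes \<phi> :: "'a \<Rightarrow> 'r::comm_ring_1"
  assumes char2: "(1::'r) + 1 = 0"
    and "length xs = length ys" "inj_on \<phi> (set xs \<union> set ys)"
  shows "weight (map2 (+) (map \<phi> xs) (map \<phi> ys)) = hamming_dist xs ys"
  using assms(2,3)
proof (induction xs ys rule: list_induct2)
  case Nil
  then show ?case by (simp add: hamming_dist_def)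
next
  case (Cons x xs y ys)
  have "u + u = 0" for u :: 'r
    using char2 by (metis distrib_right mult_1 mult_zero_left)
  then have "\<phi> x + \<phi> y = 0 \<longleftrightarrow> \<phi> x = \<phi> y"
    by (metis add_left_cancel)
  also have "\<dots> \<longleftrightarrow> x = y" using Cons.prems by (auto simp: inj_on_def)
  finally have "\<phi> x + \<phi> y = 0 \<longleftrightarrow> x = y" .
  moreover have "inj_on \<phi> (set xs \<union> set ys)"
    using Cons.prems by (rule inj_on_subset) auto
  ultimately show ?case using Cons.IH by (simp add: hamming_dist_Cons)
qed

text \<open>
  Polynomials over the two-element field form an infinite integral domain of characteristic two, so
  the finitely many letters that occur can be encoded by distinct monomials and there is room for
  generic parameters.
\<close>
lemma skew_hamming_pairs_bound:
  fixes a b :: "nat \<Rightarrow> 'a list"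
  assumes len: "\<And>i. i \<in> {1..m} \<Longrightarrow> length (a i) = n \<and> length (b i) = n"
    and diag: "\<And>i. i \<in> {1..m} \<Longrightarrow> hamming_dist (a i) (b i) \<ge> t + 1"
    and upper: "\<And>i j. 1 \<le> i \<Longrightarrow> i < j \<Longrightarrow> j \<le> m \<Longrightarrow> hamming_dist (a i) (b j) \<le> t"
  shows "m \<le> 2 ^ (t + 1)"
proof -
  have char2: "(1::bit poly) + 1 = 0"
    by (simp add: one_pCons)
  have inj_monom: "inj (\<lambda>k. monom (1::bit) k)"
    by (auto simp: inj_def monom_eq_iff')
  then have inf: "infinite (UNIV :: bit poly set)"
    using finite_subset[OF subset_UNIV] infinite_UNIV_nat range_inj_infinite by blast
  define L where "L = (\<Union>i\<in>{1..m}. set (a i) \<union> set (b i))"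
  have "finite L" unfolding L_def by simp
  then obtain e :: "'a \<Rightarrow> nat" where "inj_on e L"
    using finite_imp_inj_to_nat_seg by blast
  define \<phi> where "\<phi> x = monom (1::bit) (e x)" for x
  have inj: "inj_on \<phi> L"
    using \<open>inj_on e L\<close> inj_monom by (auto simp: \<phi>_def inj_on_def)
  define d where "d i j = map2 (+) (map \<phi> (a i)) (map \<phi> (b j))" for i j
  have wt: "weight (d i j) = hamming_dist (a i) (b j)" if "i \<in> {1..m}" "j \<in> {1..m}" for i j
    unfolding d_def
  proof (rule weight_map2_eq_hamming_dist[OF char2])
    show "inj_on \<phi> (set (a i) \<union> set (b j))"
      using inj by (rule inj_on_subset) (use that in \<open>auto simp: L_def\<close>)
  qed (use len that in simp)
  define R where "R = {1..t + 1}"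
  have R: "finite R" "0 \<notin> R" "card R = t + 1" by (auto simp: R_def)
  obtain zs where zs: "length zs = n"
    and nz: "\<And>i. i \<in> {1..m} \<Longrightarrow> card R \<le> weight (d i i) \<Longrightarrow> ext_prod zs (d i i) R \<noteq> 0"
  proof -
    have "\<forall>x\<in>(\<lambda>i. d i i) ` {1..m}. length x = n"
      using len by (auto simp: d_def)
    from ex_generic_ext_prod_nonzero[OF inf _ this R(1,2)] that show ?thesis by auto
  qed
  \<comment> \<open>Indexing \<open>q j\<close> by complements turns the top coefficient of the product into the standard pairing.\<close>
  define p where "p i = ext_prod zs (map \<phi> (a i))" for i
  define q where "q j S = ext_prod zs (map \<phi> (b j)) (R - S)" for j S
  have pair: "(\<Sum>S\<in>Pow R. p i S * q j S) = ext_prod zs (d i j) R"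
    if "i \<in> {1..m}" "j \<in> {1..m}" for i j
    using conv_ext_prod[OF char2, of zs "map \<phi> (a i)" "map \<phi> (b j)" R] len that zs R
    by (simp add: conv_def p_def q_def d_def)
  have "m \<le> card (Pow R)"
  proof (rule triangular_pairing_bound[where p = p and q = q])
    show "(\<Sum>S\<in>Pow R. p i S * q i S) \<noteq> 0" if "i \<in> {1..m}" for i
      unfolding pair[OF that that] using that diag[OF that] R wt[OF that that]
      by (intro nz) auto
    show "(\<Sum>S\<in>Pow R. p i S * q j S) = 0" if ij: "1 \<le> i" "i < j" "j \<le> m" for i j
    proof -
      have mem: "i \<in> {1..m}" "j \<in> {1..m}" using ij by auto
      have "weight (d i j) < card R" using upper[OF ij] R wt[OF mem] by simp
      then show ?thesis unfolding pair[OF mem] by (rule ext_prod_eq_0[OF R(1)])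
    qed
  qed (use R in simp)
  then show ?thesis using R by (simp add: card_Pow)
qed

section \<open>Sharpness\<close>

text \<open>
  The words \<open>a i\<close> run through all words over two letters \<open>u\<close> and \<open>v\<close>, and \<open>b i\<close> exchanges \<open>u\<close> and \<open>v\<close>
  in \<open>a i\<close>. Where \<open>a i\<close> and \<open>a j\<close> differ, \<open>a i\<close> agrees with \<open>b j\<close>.
\<close>
lemma ex_complementary_words:
  fixes X :: "'a set"
  assumes "infinite X \<or> card X \<ge> 2"
  shows "\<exists>(a :: nat \<Rightarrow> 'a list) b. (\<forall>i\<in>{1..2 ^ n}. a i \<in> words X n \<and> b i \<in> words X n) \<and>
    (\<forall>i\<in>{1..2 ^ n}. hamming_dist (a i) (b i) = n) \<and>
    (\<forall>i\<in>{1..2 ^ n}. \<forall>j\<in>{1..2 ^ n}. i \<noteq> j \<longrightarrow> hamming_dist (a i) (b j) < n)"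
proof -
  obtain u v where uv: "u \<in> X" "v \<in> X" "u \<noteq> v"
  proof -
    have "\<exists>Y\<subseteq>X. card Y = 2"
    proof (cases "finite X")
      case True
      then have "2 \<le> card X" using assms by simp
      then show ?thesis using obtain_subset_with_card_n[of 2 X] by metis
    next
      case False
      then show ?thesis using infinite_arbitrarily_large[of X 2] by blast
    qed
    then show ?thesis using that by (auto simp: card_2_iff)
  qed
  define W where "W = {w. set w \<subseteq> {u, v} \<and> length w = n}"
  have "finite W" unfolding W_def by (rule finite_lists_length_eq) simp
  have "card W = 2 ^ n"
    unfolding W_def using uv by (simp add: card_lists_length_eq numeral_2_eq_2)
  with \<open>finite W\<close> obtain a :: "nat \<Rightarrow> 'a list" where a: "bij_betw a {1..2 ^ n} W"
    using ex_bij_betw_nat_finite_1[of W] by auto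
  define c where "c x = (if x = u then v else u)" for x
  define b where "b i = map c (a i)" for i
  have aW: "a i \<in> W" if "i \<in> {1..2 ^ n}" for i
    using a that by (auto simp: bij_betw_def)
  have nth: "a i ! k \<in> {u, v}" if "i \<in> {1..2 ^ n}" "k < n" for i k
  proof -
    have "set (a i) \<subseteq> {u, v}" "k < length (a i)" using aW[OF that(1)] that(2) by (auto simp: W_def)
    then show ?thesis using nth_mem by blast
  qed
  have "a i \<in> words X n \<and> b i \<in> words X n" if "i \<in> {1..2 ^ n}" for i
    using aW[OF that] uv by (auto simp: W_def words_def b_def c_def)
  moreover have "hamming_dist (a i) (b i) = n" if "i \<in> {1..2 ^ n}" for i
  proof -
    have "{k. k < length (a i) \<and> a i ! k \<noteq> b i ! k} = {..<n}"
      using aW[OF that] uv by (auto simp: W_def b_def c_def split: if_splits)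
    then show ?thesis by (simp add: hamming_dist_def)
  qed
  moreover have "hamming_dist (a i) (b j) < n"
    if ij: "i \<in> {1..2 ^ n}" "j \<in> {1..2 ^ n}" "i \<noteq> j" for i j
  proof -
    have "a i \<noteq> a j" using a ij by (auto simp: bij_betw_def inj_on_def)
    moreover have len: "length (a i) = n" "length (a j) = n"
      using aW ij by (auto simp: W_def)
    ultimately obtain k where k: "k < n" "a i ! k \<noteq> a j ! k"
      by (metis nth_equalityI)
    then have "a i ! k = b j ! k"
      using nth[of i k] nth[of j k] ij len by (auto simp: b_def c_def)
    then have "{l. l < length (a i) \<and> a i ! l \<noteq> b j ! l} \<subset> {..<n}"
      using k len by auto
    from psubset_card_mono[OF _ this] show ?thesis by (simp add: hamming_dist_def)
  qed
  ultimately show ?thesis by blast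
qed

theorem theorem2p2:
  shows
    "(\<forall>(t::nat) (m::nat) (n::nat) (X::'a set) (a::nat \<Rightarrow> 'a list) (b::nat \<Rightarrow> 'a list).
        m \<ge> 1 \<longrightarrow> n \<ge> 1 \<longrightarrow> n \<ge> t + 1 \<longrightarrow>
        (\<forall>i\<in>{1..m}. a i \<in> words X n \<and> b i \<in> words X n) \<longrightarrow>
        (\<forall>i\<in>{1..m}. hamming_dist (a i) (b i) \<ge> t + 1) \<longrightarrow>
        (\<forall>i j. 1 \<le> i \<and> i < j \<and> j \<le> m \<longrightarrow> hamming_dist (a i) (b j) \<le> t) \<longrightarrow>
        m \<le> 2 ^ (t + 1))
     \<and>
     (\<forall>(t::nat) (X::'a set).
        (infinite X \<or> card X \<ge> 2) \<longrightarrow>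
        (\<exists>(a::nat \<Rightarrow> 'a list) (b::nat \<Rightarrow> 'a list).
          (\<forall>i\<in>{1..2 ^ (t + 1)}. a i \<in> words X (t + 1) \<and> b i \<in> words X (t + 1)) \<and>
          (\<forall>i\<in>{1..2 ^ (t + 1)}. hamming_dist (a i) (b i) \<ge> t + 1) \<and>
          (\<forall>i j. 1 \<le> i \<and> i < j \<and> j \<le> 2 ^ (t + 1) \<longrightarrow> hamming_dist (a i) (b j) \<le> t)))"
proof (intro conjI allI impI)
  fix t m n :: nat and X :: "'a set" and a b :: "nat \<Rightarrow> 'a list"
  assume "\<forall>i\<in>{1..m}. a i \<in> words X n \<and> b i \<in> words X n"
    and "\<forall>i\<in>{1..m}. hamming_dist (a i) (b i) \<ge> t + 1"
    and "\<forall>i j. 1 \<le> i \<and> i < j \<and> j \<le> m \<longrightarrow> hamming_dist (a i) (b j) \<le> t"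
  then show "m \<le> 2 ^ (t + 1)"
    by (intro skew_hamming_pairs_bound[of m a n b t]) (auto simp: words_def)
next
  fix t :: nat and X :: "'a set"
  assume "infinite X \<or> card X \<ge> 2"
  from ex_complementary_words[OF this, of "t + 1"] obtain a b :: "nat \<Rightarrow> 'a list" where
    "\<forall>i\<in>{1..2 ^ (t + 1)}. a i \<in> words X (t + 1) \<and> b i \<in> words X (t + 1)"
    "\<forall>i\<in>{1..2 ^ (t + 1)}. hamming_dist (a i) (b i) = t + 1"
    and off: "\<forall>i\<in>{1..2 ^ (t + 1)}. \<forall>j\<in>{1..2 ^ (t + 1)}. i \<noteq> j \<longrightarrow>
      hamming_dist (a i) (b j) < t + 1"
    by blast
  moreover have "\<forall>i j. 1 \<le> i \<and> i < j \<and> j \<le> 2 ^ (t + 1) \<longrightarrow> hamming_dist (a i) (b j) \<le> t"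
  proof (intro allI impI)
    fix i j :: nat
    assume ij: "1 \<le> i \<and> i < j \<and> j \<le> 2 ^ (t + 1)"
    then have "i \<in> {1..2 ^ (t + 1)}" "j \<in> {1..2 ^ (t + 1)}" "i \<noteq> j" by auto
    with off have "hamming_dist (a i) (b j) < t + 1" by blast
    then show "hamming_dist (a i) (b j) \<le> t" by simp
  qed
  ultimately show "\<exists>(a::nat \<Rightarrow> 'a list) (b::nat \<Rightarrow> 'a list).
          (\<forall>i\<in>{1..2 ^ (t + 1)}. a i \<in> words X (t + 1) \<and> b i \<in> words X (t + 1)) \<and>
          (\<forall>i\<in>{1..2 ^ (t + 1)}. hamming_dist (a i) (b i) \<ge> t + 1) \<and>
          (\<forall>i j. 1 \<le> i \<and> i < j \<and> j \<le> 2 ^ (t + 1) \<longrightarrow> hamming_dist (a i) (b j) \<le> t)"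
    by (intro exI[of _ a] exI[of _ b]) auto
qed

end
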